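(* Let $(T,\vdash,\dashv,\perp)$ be a triassociative algebra. Then $T$ is nilpotent (as a triassociative algebra) if and only if the associative algebra $(T,\perp)$ is nilpotent.
   Context: A triassociative algebra $(T,\vdash,\dashv,\perp)$ is a vector space $T$ over a field with three bilinear products $\vdash,\dashv,\perp:T\times T\to T$ satisfying, for all $x,y,z\in T$: (A1) $(x\vdash y)\vdash z=x\vdash(y\vdash z)$; (A2) $(x\dashv y)\dashv z=x\dashv(y\dashv z)$; (D1) $(x\dashv y)\vdash z=x\vdash(y\vdash z)$; (D2) $(x\dashv y)\dashv z=x\dashv(y\vdash z)$; (S1) $(x\vdash y)\dashv z=x\vdash(y\dashv z)$; (T1) $(x\perp y)\vdash z=x\vdash(y\vdash z)$; (T2) $(x\dashv y)\dashv z=x\dashv(y\perp z)$; (T3) $(x\vdash y)\perp z=x\vdash(y\perp z)$; (T4) $(x\perp y)\dashv z=x\perp(y\dashv z)$; (S2) $(x\dashv y)\perp z=x\perp(y\vdash z)$; (A3) $(x\perp y)\perp z=x\perp(y\perp z)$. In particular $(T,\vdash)$, $(T,\dashv)$, $(T,\perp)$ are (not necessarily unital) associative algebras. For subspaces $A,B\subseteq T$ and $\ast\in\{\vdash,\dashv,\perp\}$, $A\ast B$ is the span of all $a\ast b$ with $a\in A$, $b\in B$, and $A\lozenge B=A\vdash B+A\dashv B+A\perp B$. Set $T^1=T$ and $T^{n+1}=T^1\lozenge T^n+T^2\lozenge T^{n-1}+\cdots+T^n\lozenge T^1$ for $n\ge 1$. $T$ is nilpotent if $T^n=0$ for some $n\in\mathbb{N}$.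 An associative algebra $A$ is nilpotent if $A^n=0$ for some $n\in\mathbb{N}$, where $A^n$ is the ideal generated by all $n$-fold products of elements of $A$. *)

theory Defs
  imports Main "HOL.Vector_Spaces" "HOL.Hull" "HOL-Library.Set_Algebras"
begin

context vector_space
begin

definition bilinear_product :: "('b \<Rightarrow> 'b \<Rightarrow> 'b) \<Rightarrow> bool" where
  "bilinear_product f \<longleftrightarrow>
     (\<forall>y. Vector_Spaces.linear scale scale (\<lambda>x. f x y)) \<and>
     (\<forall>x. Vector_Spaces.linear scale scale (\<lambda>y. f x y))"

definition span_product :: "('b \<Rightarrow> 'b \<Rightarrow> 'b) \<Rightarrow> 'b set \<Rightarrow> 'b set \<Rightarrow> 'b set" where
  "span_product f A B = span {f a b | a b. a \<in> A \<and> b \<in> B}"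

end

locale associative_algebra = vector_space scale
  for scale :: "'k::field \<Rightarrow> 'a::ab_group_add \<Rightarrow> 'a" +
  fixes mult :: "'a \<Rightarrow> 'a \<Rightarrow> 'a" (infixl "\<cdot>" 70)
  assumes bilinear_mult: "bilinear_product (\<cdot>)"
    and mult_assoc: "(x \<cdot> y) \<cdot> z = x \<cdot> (y \<cdot> z)"
begin

definition is_ideal :: "'a set \<Rightarrow> bool" where
  "is_ideal I \<longleftrightarrow> subspace I \<and> (\<forall>a. \<forall>x\<in>I. a \<cdot> x \<in> I \<and> x \<cdot> a \<in> I)"

text \<open>
  \<open>is_nfold_product n x\<close>: \<open>x\<close> is a product of \<open>n \<ge> 1\<close> elements of the algebra, bracketed
  in some way (by associativity the bracketing is immaterial).
\<close>

inductive is_nfold_product :: "nat \<Rightarrow> 'a \<Rightarrow> bool" where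
  single: "is_nfold_product 1 x"
| mult: "is_nfold_product m x \<Longrightarrow> is_nfold_product n y \<Longrightarrow> is_nfold_product (m + n) (x \<cdot> y)"

definition ideal_power :: "nat \<Rightarrow> 'a set" where
  "ideal_power n = is_ideal hull {x. is_nfold_product n x}"

definition nilpotent :: bool where
  "nilpotent \<longleftrightarrow> (\<exists>n\<ge>1. ideal_power n = {0})"

end

locale triassociative_algebra = vector_space scale
  for scale :: "'k::field \<Rightarrow> 'a::ab_group_add \<Rightarrow> 'a" +
  fixes vd :: "'a \<Rightarrow> 'a \<Rightarrow> 'a" (infixl "\<turnstile>" 70)
    and dv :: "'a \<Rightarrow> 'a \<Rightarrow> 'a" (infixl "\<stileturn>" 70)
    and pp :: "'a \<Rightarrow> 'a \<Rightarrow> 'a" (infixl "\<bottom>" 70)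
  assumes bilinear_vd: "bilinear_product (\<turnstile>)"
    and bilinear_dv: "bilinear_product (\<stileturn>)"
    and bilinear_pp: "bilinear_product (\<bottom>)"
    and A1: "(x \<turnstile> y) \<turnstile> z = x \<turnstile> (y \<turnstile> z)"
    and A2: "(x \<stileturn> y) \<stileturn> z = x \<stileturn> (y \<stileturn> z)"
    and D1: "(x \<stileturn> y) \<turnstile> z = x \<turnstile> (y \<turnstile> z)"
    and D2: "(x \<stileturn> y) \<stileturn> z = x \<stileturn> (y \<turnstile> z)"
    and S1: "(x \<turnstile> y) \<stileturn> z = x \<turnstile> (y \<stileturn> z)"
    and T1: "(x \<bottom> y) \<turnstile> z = x \<turnstile> (y \<turnstile> z)"
    and T2: "(x \<stileturn> y) \<stileturn> z = x \<stileturn> (y \<bottom> z)"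
    and T3: "(x \<turnstile> y) \<bottom> z = x \<turnstile> (y \<bottom> z)"
    and T4: "(x \<bottom> y) \<stileturn> z = x \<bottom> (y \<stileturn> z)"
    and S2: "(x \<stileturn> y) \<bottom> z = x \<bottom> (y \<turnstile> z)"
    and A3: "(x \<bottom> y) \<bottom> z = x \<bottom> (y \<bottom> z)"
begin

text \<open>\<open>+\<close> and \<open>\<Sum>\<close> on sets of vectors are the elementwise (Minkowski) sums.\<close>

definition lozenge :: "'a set \<Rightarrow> 'a set \<Rightarrow> 'a set" (infixl "\<lozenge>" 70) where
  "A \<lozenge> B = span_product (\<turnstile>) A B + span_product (\<stileturn>) A B + span_product (\<bottom>) A B"

text \<open>The value at \<open>0\<close> is a dummy: the sequence \<open>T\<^sup>n\<close> starts at \<open>n = 1\<close>.\<close>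

fun tri_power :: "nat \<Rightarrow> 'a set" where
  "tri_power 0 = UNIV"
| "tri_power (Suc 0) = UNIV"
| "tri_power (Suc (Suc n)) =
     (\<Sum>i\<in>{1..Suc n}. tri_power i \<lozenge> tri_power (Suc (Suc n) - i))"

definition nilpotent :: bool where
  "nilpotent \<longleftrightarrow> (\<exists>n\<ge>1. tri_power n = {0})"

end

sublocale triassociative_algebra \<subseteq> perp: associative_algebra scale "(\<bottom>)"
  by unfold_locales (fact bilinear_pp, fact A3)

end

theory Submission
  imports Defs
begin

text \<open>
  One implication is immediate: products for \<open>\<bottom>\<close> are among the products whose span is \<open>T\<^sup>n\<close>.

  For the converse, suppose that all \<open>n\<close>-fold products for \<open>\<bottom>\<close> vanish. The axioms bring every
  monomial in the three operations to the shape

    \<open>(u\<^sub>0 \<turnstile> m\<^sub>1) \<bottom> (u\<^sub>1 \<turnstile> m\<^sub>2) \<bottom> \<dots> \<bottom> (v \<turnstile> m\<^sub>k \<stileturn> w)\<close>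

  with \<open>k\<close> single elements \<open>m\<^sub>1, \<dots>, m\<^sub>k\<close> and \<open>k + 1\<close> gaps \<open>u\<^sub>0, u\<^sub>1, \<dots>, v, w\<close> between and around
  them, each gap being itself a monomial or absent.
  Two observations bound the length of a nonzero monomial.
  \<^item> By (T3) and (T4) it is a \<open>k\<close>-fold product for \<open>\<bottom>\<close>, so \<open>k < n\<close>.
  \<^item> Inside a left factor of \<open>\<turnstile>\<close> or a right factor of \<open>\<stileturn>\<close>, all three operations
    act alike, so a gap may be replaced by the \<open>\<bottom>\<close>-product of its entries
    (\<open>exists_perp_product_same_action\<close>). Hence every gap has length less than \<open>n\<close>.

  So the length is at most \<open>k + (k + 1) (n - 1)\<close>, which is less than \<open>n\<^sup>2\<close>, and therefore
  \<open>T\<^sup>N = 0\<close> for \<open>N = n\<^sup>2\<close>.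

  The full normal form is never written down. An induction on
  monomials (\<open>nonzero_tri_product_shape\<close>) only has to record \<open>k\<close> and the two outer gaps, because
  a new inner gap arises only where a product \<open>a \<bottom> b\<close> joins the right gap of \<open>a\<close> to the left
  gap of \<open>b\<close>.
\<close>

section \<open>Products of many elements in an associative algebra\<close>

context associative_algebra
begin

lemma is_nfold_product_pos: "is_nfold_product n x \<Longrightarrow> 1 \<le> n"
  by (induction rule: is_nfold_product.induct) auto

lemma is_nfold_product_split_first:
  assumes "is_nfold_product m x" and "2 \<le> m"
  shows "\<exists>y z. is_nfold_product (m - 1) z \<and> x = y \<cdot> z"
  using assms
proof (induction rule: is_nfold_product.induct)
  case (single x)
  then show ?case by simp
next
  case (mult m x n y)
  show ?case
  proof (cases "m = 1")
    case True
    then show ?thesis using mult.hyps by auto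
  next
    case False
    with is_nfold_product_pos[OF mult.hyps(1)] have m: "2 \<le> m" by simp
    with mult.IH(1) obtain a b where ab: "is_nfold_product (m - 1) b" "x = a \<cdot> b" by blast
    have "is_nfold_product (m + n - 1) (b \<cdot> y)"
      using is_nfold_product.mult[OF ab(1) mult.hyps(2)] m by simp
    then show ?thesis using ab(2) mult_assoc by blast
  qed
qed

lemma mult_zero [simp]: "x \<cdot> 0 = 0" "0 \<cdot> x = 0"
proof -
  have "Vector_Spaces.linear scale scale (\<lambda>y. x \<cdot> y)"
    and "Vector_Spaces.linear scale scale (\<lambda>y. y \<cdot> x)"
    using bilinear_mult by (auto simp: bilinear_product_def)
  from this[THEN Vector_Spaces.linear.axioms(3), THEN module_hom.zero]
  show "x \<cdot> 0 = 0" "0 \<cdot> x = 0" .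
qed

lemma ideal_power_eq_zero_iff:
  "ideal_power n = {0} \<longleftrightarrow> (\<forall>x. is_nfold_product n x \<longrightarrow> x = 0)"
proof
  assume "ideal_power n = {0}"
  moreover have "{x. is_nfold_product n x} \<subseteq> ideal_power n"
    unfolding ideal_power_def by (rule hull_subset)
  ultimately show "\<forall>x. is_nfold_product n x \<longrightarrow> x = 0" by auto
next
  assume *: "\<forall>x. is_nfold_product n x \<longrightarrow> x = 0"
  have "is_ideal {0}"
    by (simp add: is_ideal_def)
  with * have "ideal_power n \<subseteq> {0}"
    unfolding ideal_power_def by (intro hull_minimal) auto
  moreover have "0 \<in> ideal_power n"
    by (auto simp: ideal_power_def hull_def is_ideal_def intro: subspace_0)
  ultimately show "ideal_power n = {0}" by blast
qed

lemma is_nfold_product_eq_zero_mono: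
  assumes vanish: "\<And>x. is_nfold_product n x \<Longrightarrow> x = 0" and "1 \<le> n"
    and "n \<le> m" "is_nfold_product m x"
  shows "x = 0"
  using assms(3,4)
proof (induction m arbitrary: x rule: dec_induct)
  case base
  then show ?case by (rule vanish)
next
  case (step m)
  from is_nfold_product_split_first[OF step.prems] obtain y z
    where "is_nfold_product m z" "x = y \<cdot> z"
    using step.hyps \<open>1 \<le> n\<close> by auto
  with step.IH[of z] show ?case by simp
qed

end

section \<open>Monomials and the powers of a triassociative algebra\<close>

context triassociative_algebra
begin

lemma associative_algebra_vd: "associative_algebra scale (\<turnstile>)"
  by unfold_locales (fact bilinear_vd, fact A1)

lemma associative_algebra_dv: "associative_algebra scale (\<stileturn>)"
  by unfold_locales (fact bilinear_dv, fact A2)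

lemmas vd_zero [simp] = associative_algebra.mult_zero[OF associative_algebra_vd]
lemmas dv_zero [simp] = associative_algebra.mult_zero[OF associative_algebra_dv]

inductive tri_product :: "nat \<Rightarrow> 'a \<Rightarrow> bool" where
  single: "tri_product 1 x"
| vd: "tri_product m x \<Longrightarrow> tri_product n y \<Longrightarrow> tri_product (m + n) (x \<turnstile> y)"
| dv: "tri_product m x \<Longrightarrow> tri_product n y \<Longrightarrow> tri_product (m + n) (x \<stileturn> y)"
| pp: "tri_product m x \<Longrightarrow> tri_product n y \<Longrightarrow> tri_product (m + n) (x \<bottom> y)"

lemma zero_in_span_product: "0 \<in> span_product f A B"
  by (simp add: span_product_def span_zero)

lemma zero_in_lozenge: "0 \<in> A \<lozenge> B"
  unfolding lozenge_def
  by (metis add.right_neutral set_plus_intro zero_in_span_product)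

lemma perp_in_lozenge:
  assumes "a \<in> A" "b \<in> B"
  shows "a \<bottom> b \<in> A \<lozenge> B"
proof -
  have "a \<bottom> b \<in> span_product (\<bottom>) A B"
    unfolding span_product_def using assms by (intro span_base) blast
  then have "(0 + 0) + a \<bottom> b \<in> A \<lozenge> B"
    unfolding lozenge_def by (intro set_plus_intro zero_in_span_product)
  then show ?thesis by simp
qed

lemma set_plus_subset_subspace:
  assumes "subspace V" "A \<subseteq> V" "B \<subseteq> V"
  shows "A + B \<subseteq> V"
  using assms by (auto simp: set_plus_def intro!: subspace_add)

lemma set_sum_subset_subspace:
  assumes "subspace V" "\<And>i. i \<in> I \<Longrightarrow> A i \<subseteq> V"
  shows "(\<Sum>i\<in>I. A i) \<subseteq> V"
  using assms(2)
proof (induction I rule: infinite_finite_induct)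
  case (insert i I)
  have "A i + (\<Sum>i\<in>I. A i) \<subseteq> V"
    using insert.IH insert.prems by (intro set_plus_subset_subspace[OF assms(1)]) auto
  then show ?case using insert.hyps by simp
qed (auto simp: set_zero subspace_0[OF assms(1)])

lemma set_sum_superset:
  assumes "finite I" "i \<in> I" "\<And>j. j \<in> I \<Longrightarrow> 0 \<in> A j"
  shows "A i \<subseteq> (\<Sum>j\<in>I. A j)"
proof
  fix x assume x: "x \<in> A i"
  have "0 \<in> (\<Sum>j\<in>J. A j)" if "J \<subseteq> I" for J
  proof -
    from that have "finite J" using assms(1) finite_subset by blast
    then show ?thesis using that
    proof (induction J)
      case empty
      then show ?case by (simp add: set_zero)
    next
      case (insert j J)
      then have "0 + 0 \<in> A j + (\<Sum>j\<in>J. A j)"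
        by (intro set_plus_intro assms(3)) auto
      with insert.hyps show ?case by simp
    qed
  qed
  then have "x + 0 \<in> A i + (\<Sum>j\<in>I - {i}. A j)"
    by (intro set_plus_intro x) auto
  then show "x \<in> (\<Sum>j\<in>I. A j)"
    using assms(1,2) by (simp add: sum.remove)
qed

lemma lozenge_subset_tri_power:
  assumes "1 \<le> m" "1 \<le> n"
  shows "tri_power m \<lozenge> tri_power n \<subseteq> tri_power (m + n)"
proof -
  from assms obtain q where q: "m + n = Suc (Suc q)"
    by (metis Suc_le_D add_Suc_right add_Suc_shift One_nat_def)
  have "tri_power m \<lozenge> tri_power (Suc (Suc q) - m) \<subseteq> tri_power (Suc (Suc q))"
    using set_sum_superset[of "{1..Suc q}" m "\<lambda>i. tri_power i \<lozenge> tri_power (Suc (Suc q) - i)"]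
      q assms zero_in_lozenge by auto
  with q show ?thesis
    by (metis diff_add_inverse)
qed

lemma perp_product_in_tri_power:
  "perp.is_nfold_product n x \<Longrightarrow> x \<in> tri_power n"
proof (induction rule: perp.is_nfold_product.induct)
  case (single x)
  then show ?case by simp
next
  case (mult m x n y)
  then show ?case
    using lozenge_subset_tri_power perp_in_lozenge perp.is_nfold_product_pos by blast
qed

text \<open>
  By bilinearity it is enough to multiply generators. This is what lets the iterated products of
  subspaces that define \<open>T\<^sup>n\<close> be controlled by monomials alone.
\<close>

lemma bilinear_product_in_subspace:
  assumes f: "bilinear_product f" and V: "subspace V"
    and gen: "\<And>a b. a \<in> A \<Longrightarrow> b \<in> B \<Longrightarrow> f a b \<in> V"
    and x: "x \<in> span A" and y: "y \<in> span B"
  shows "f x y \<in> V"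
proof -
  have linl: "Vector_Spaces.linear scale scale (\<lambda>x. f x y)"
    and linr: "Vector_Spaces.linear scale scale (\<lambda>y. f x y)" for x y
    using f by (auto simp: bilinear_product_def)
  have right: "f a y \<in> V" if "a \<in> A" for a
  proof -
    have "subspace {y. f a y \<in> V}"
      using module_hom.subspace_vimage[OF linear.axioms(3)[OF linr] V] by (simp add: vimage_def)
    then show ?thesis
      using span_minimal[of B "{y. f a y \<in> V}"] gen that y by auto
  qed
  have "subspace {x. f x y \<in> V}"
    using module_hom.subspace_vimage[OF linear.axioms(3)[OF linl] V] by (simp add: vimage_def)
  then show ?thesis
    using span_minimal[of A "{x. f x y \<in> V}"] right x by auto
qed

lemma tri_power_subset_span:
  "1 \<le> n \<Longrightarrow> tri_power n \<subseteq> span {x. tri_product n x}"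
proof (induction n rule: tri_power.induct)
  case 1
  then show ?case by simp
next
  case 2
  have "x \<in> span {x. tri_product (Suc 0) x}" for x
    using tri_product.single by (intro span_base) simp
  then show ?case by auto
next
  case (3 n)
  let ?V = "span {x. tri_product (Suc (Suc n)) x}"
  have "tri_power i \<lozenge> tri_power (Suc (Suc n) - i) \<subseteq> ?V" if i: "i \<in> {1..Suc n}" for i
  proof -
    let ?j = "Suc (Suc n) - i"
    have j: "i + ?j = Suc (Suc n)" "1 \<le> ?j" using i by auto
    have sub: "span_product f (tri_power i) (tri_power ?j) \<subseteq> ?V"
      if f: "bilinear_product f"
        and gen: "\<And>a b. tri_product i a \<Longrightarrow> tri_product ?j b \<Longrightarrow> tri_product (i + ?j) (f a b)"
      for f
    proof -
      have "f a b \<in> ?V" if "a \<in> tri_power i" "b \<in> tri_power ?j" for a b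
      proof (rule bilinear_product_in_subspace[OF f subspace_span])
        show "a \<in> span {x. tri_product i x}" using "3.IH"(1)[OF i] i that by auto
        show "b \<in> span {x. tri_product ?j x}" using "3.IH"(2)[OF i] j(2) that by auto
        show "f a b \<in> ?V" if "a \<in> {x. tri_product i x}" "b \<in> {x. tri_product ?j x}" for a b
          using gen[of a b] that unfolding j(1) by (intro span_base) simp
      qed
      then show ?thesis
        unfolding span_product_def by (intro span_minimal subspace_span) auto
    qed
    show ?thesis
      unfolding lozenge_def
      by (intro set_plus_subset_subspace subspace_span sub
          bilinear_vd bilinear_dv bilinear_pp tri_product.intros)
  qed
  then show ?case
    unfolding tri_power.simps by (intro set_sum_subset_subspace subspace_span)
qed

section \<open>The length of a nonzero monomial\<close>

text \<open>
  By (A1), (D1), (T1) the element \<open>(x \<circ> y) \<turnstile> z\<close> is the same for all three choices of \<open>\<circ>\<close>, and by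
  (A2), (D2), (T2) so is \<open>z \<stileturn> (x \<circ> y)\<close>. So in these positions every operation inside a monomial
  can be exchanged for \<open>\<bottom>\<close>.
\<close>

lemma exists_perp_product_same_action:
  assumes "tri_product m x"
  shows "\<exists>p. perp.is_nfold_product m p \<and> (\<forall>z. x \<turnstile> z = p \<turnstile> z) \<and> (\<forall>z. z \<stileturn> x = z \<stileturn> p)"
proof -
  have join: "\<exists>p. perp.is_nfold_product (m + n) p \<and>
      (\<forall>z. x \<turnstile> (y \<turnstile> z) = p \<turnstile> z) \<and> (\<forall>z. (z \<stileturn> x) \<stileturn> y = z \<stileturn> p)"
    if "\<exists>p. perp.is_nfold_product m p \<and> (\<forall>z. x \<turnstile> z = p \<turnstile> z) \<and> (\<forall>z. z \<stileturn> x = z \<stileturn> p)"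
      and "\<exists>p. perp.is_nfold_product n p \<and> (\<forall>z. y \<turnstile> z = p \<turnstile> z) \<and> (\<forall>z. z \<stileturn> y = z \<stileturn> p)"
    for m n x y
  proof -
    from that obtain p q where p: "perp.is_nfold_product m p"
      "\<And>z. x \<turnstile> z = p \<turnstile> z" "\<And>z. z \<stileturn> x = z \<stileturn> p"
      and q: "perp.is_nfold_product n q" "\<And>z. y \<turnstile> z = q \<turnstile> z" "\<And>z. z \<stileturn> y = z \<stileturn> q"
      by blast
    have "x \<turnstile> (y \<turnstile> z) = (p \<bottom> q) \<turnstile> z" "(z \<stileturn> x) \<stileturn> y = z \<stileturn> (p \<bottom> q)" for z
      by (simp_all add: p q T1 T2)
    with perp.is_nfold_product.mult[OF p(1) q(1)] show ?thesis by blast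
  qed
  from assms show ?thesis
  proof (induction rule: tri_product.induct)
    case (single x)
    then show ?case using perp.is_nfold_product.single by blast
  next
    case (vd m x n y)
    then show ?case using join[OF vd.IH] by (simp add: A1 D2[symmetric])
  next
    case (dv m x n y)
    then show ?case using join[OF dv.IH] by (simp add: D1 A2[symmetric])
  next
    case (pp m x n y)
    then show ?case using join[OF pp.IH] by (simp add: T1 T2[symmetric])
  qed
qed

text \<open>The case of \<open>0\<close> stands for an absent gap, since the algebra need not have a unit to fill it.\<close>

definition left_gap :: "nat \<Rightarrow> 'a \<Rightarrow> bool" where
  "left_gap l x \<longleftrightarrow> l = 0 \<or> (\<exists>u y. tri_product l u \<and> x = u \<turnstile> y)"

definition right_gap :: "nat \<Rightarrow> 'a \<Rightarrow> bool" where
  "right_gap r x \<longleftrightarrow> r = 0 \<or> (\<exists>y v. tri_product r v \<and> x = y \<stileturn> v)"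

lemma left_gap_vd:
  assumes "tri_product m x" "left_gap l y"
  shows "left_gap (m + l) (x \<turnstile> y)"
proof (cases "l = 0")
  case True
  with assms(1) show ?thesis by (auto simp: left_gap_def)
next
  case False
  with assms(2) obtain u z where u: "tri_product l u" "y = u \<turnstile> z" by (auto simp: left_gap_def)
  then have "x \<turnstile> y = (x \<turnstile> u) \<turnstile> z" by (simp add: A1)
  with tri_product.vd[OF assms(1) u(1)] show ?thesis unfolding left_gap_def by blast
qed

lemma left_gap_dv: "left_gap l x \<Longrightarrow> left_gap l (x \<stileturn> y)"
  unfolding left_gap_def using S1 by blast

lemma left_gap_pp: "left_gap l x \<Longrightarrow> left_gap l (x \<bottom> y)"
  unfolding left_gap_def using T3 by blast

lemma right_gap_dv:
  assumes "right_gap r x" "tri_product m y"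
  shows "right_gap (r + m) (x \<stileturn> y)"
proof (cases "r = 0")
  case True
  with assms(2) show ?thesis by (auto simp: right_gap_def)
next
  case False
  with assms(1) obtain z v where v: "tri_product r v" "x = z \<stileturn> v" by (auto simp: right_gap_def)
  then have "x \<stileturn> y = z \<stileturn> (v \<stileturn> y)" by (simp add: A2)
  with tri_product.dv[OF v(1) assms(2)] show ?thesis unfolding right_gap_def by blast
qed

lemma right_gap_vd: "right_gap r y \<Longrightarrow> right_gap r (x \<turnstile> y)"
  unfolding right_gap_def using S1[symmetric] by blast

lemma right_gap_pp: "right_gap r y \<Longrightarrow> right_gap r (x \<bottom> y)"
  unfolding right_gap_def using T4[symmetric] by blast

text \<open>The outer factor is absorbed by the first, respectively the last, factor of the product.\<close>

lemma perp_product_vd: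
  "perp.is_nfold_product k y \<Longrightarrow> perp.is_nfold_product k (x \<turnstile> y)"
proof (induction rule: perp.is_nfold_product.induct)
  case (single y)
  show ?case by (rule perp.is_nfold_product.single)
next
  case (mult m y n z)
  then show ?case
    using perp.is_nfold_product.mult by (simp flip: T3)
qed

lemma perp_product_dv:
  "perp.is_nfold_product k x \<Longrightarrow> perp.is_nfold_product k (x \<stileturn> y)"
proof (induction rule: perp.is_nfold_product.induct)
  case (single x)
  show ?case by (rule perp.is_nfold_product.single)
next
  case (mult m x n z)
  then show ?case
    using perp.is_nfold_product.mult by (simp add: T4)
qed

text \<open>
  The hypothesis of the next lemmas is that a long monomial annihilates as a left factor of \<open>\<turnstile>\<close>
  (respectively as a right factor of \<open>\<stileturn>\<close>). It follows from nilpotency of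
  \<open>\<bottom>\<close> by \<open>exists_perp_product_same_action\<close>.
\<close>

lemma left_gap_less:
  assumes "\<forall>m u z. tri_product m u \<longrightarrow> n \<le> m \<longrightarrow> u \<turnstile> z = 0"
    and "left_gap l x" "x \<noteq> 0" "1 \<le> n"
  shows "l < n"
  using assms by (force simp: left_gap_def not_le[symmetric])

lemma right_gap_less:
  assumes "\<forall>m v z. tri_product m v \<longrightarrow> n \<le> m \<longrightarrow> z \<stileturn> v = 0"
    and "right_gap r x" "x \<noteq> 0" "1 \<le> n"
  shows "r < n"
  using assms by (force simp: right_gap_def not_le[symmetric])

text \<open>
  Axiom (S2) carries the right gap \<open>v\<close> of \<open>x\<close> across \<open>\<bottom>\<close>, where (A1) merges it with the left gap
  \<open>u\<close> of \<open>y\<close> into the single gap \<open>v \<turnstile> u\<close>.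
\<close>

lemma inner_gap_less:
  assumes vanish: "\<forall>m u z. tri_product m u \<longrightarrow> n \<le> m \<longrightarrow> u \<turnstile> z = 0"
    and gaps: "right_gap r x" "left_gap l y" and "x \<bottom> y \<noteq> 0" "1 \<le> n"
  shows "r + l < n"
proof -
  have "y \<noteq> 0" using \<open>x \<bottom> y \<noteq> 0\<close> by auto
  show ?thesis
  proof (cases "r = 0")
    case True
    with left_gap_less[OF vanish gaps(2) \<open>y \<noteq> 0\<close> \<open>1 \<le> n\<close>] show ?thesis by simp
  next
    case False
    with gaps(1) obtain x' v where v: "tri_product r v" "x = x' \<stileturn> v"
      by (auto simp: right_gap_def)
    have "x \<bottom> y = x' \<bottom> (v \<turnstile> y)" by (simp add: v S2)
    with \<open>x \<bottom> y \<noteq> 0\<close> have "v \<turnstile> y \<noteq> 0" by auto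
    with left_gap_less[OF vanish left_gap_vd[OF v(1) gaps(2)] _ \<open>1 \<le> n\<close>] show ?thesis by simp
  qed
qed

text \<open>
  Here \<open>k\<close> counts the factors \<open>m\<^sub>1, \<dots>, m\<^sub>k\<close> of the normal form and \<open>l\<close>, \<open>r\<close> are the lengths of its
  outer gaps. The \<open>k - 1\<close> inner gaps have length at most \<open>n - 1\<close> each, so the total length \<open>N\<close>
  satisfies \<open>N \<le> l + r + k + (k - 1) (n - 1)\<close>. The stated inequality is this one, freed of
  subtraction.
\<close>

lemma nonzero_tri_product_shape:
  assumes vanish: "\<forall>m u z. tri_product m u \<longrightarrow> n \<le> m \<longrightarrow> u \<turnstile> z = 0"
    and "1 \<le> n" and "tri_product N x" "x \<noteq> 0"
  shows "\<exists>k l r. perp.is_nfold_product k x \<and> left_gap l x \<and> right_gap r x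
           \<and> N + n \<le> l + r + 1 + k * n"
  using assms(3,4)
proof (induction rule: tri_product.induct)
  case (single x)
  have "perp.is_nfold_product 1 x" "left_gap 0 x" "right_gap 0 x" "1 + n \<le> 0 + 0 + 1 + 1 * n"
    by (auto simp: left_gap_def right_gap_def intro: perp.is_nfold_product.single[unfolded One_nat_def])
  then show ?case by blast
next
  case (vd M x N y)
  then have "y \<noteq> 0" by auto
  with vd.IH(2) obtain k l r where y: "perp.is_nfold_product k y" "left_gap l y" "right_gap r y"
    "N + n \<le> l + r + 1 + k * n" by blast
  have "(M + N) + n \<le> (M + l) + r + 1 + k * n" using y(4) by simp
  with perp_product_vd[OF y(1)] left_gap_vd[OF vd.hyps(1) y(2)] right_gap_vd[OF y(3)]
  show ?case by blast
next
  case (dv M x N y)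
  then have "x \<noteq> 0" by auto
  with dv.IH(1) obtain k l r where x: "perp.is_nfold_product k x" "left_gap l x" "right_gap r x"
    "M + n \<le> l + r + 1 + k * n" by blast
  have "(M + N) + n \<le> l + (r + N) + 1 + k * n" using x(4) by simp
  with perp_product_dv[OF x(1)] left_gap_dv[OF x(2)] right_gap_dv[OF x(3) dv.hyps(2)]
  show ?case by blast
next
  case (pp M x N y)
  then have "x \<noteq> 0" "y \<noteq> 0" by auto
  with pp.IH obtain k l r k' l' r' where
    x: "perp.is_nfold_product k x" "left_gap l x" "right_gap r x" "M + n \<le> l + r + 1 + k * n" and
    y: "perp.is_nfold_product k' y" "left_gap l' y" "right_gap r' y" "N + n \<le> l' + r' + 1 + k' * n"
    by blast
  have "r + l' < n"
    using inner_gap_less[OF vanish x(3) y(2) pp.prems \<open>1 \<le> n\<close>] .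
  then have "(M + N) + n \<le> l + r' + 1 + (k + k') * n"
    using x(4) y(4) by (simp add: add_mult_distrib)
  with perp.is_nfold_product.mult[OF x(1) y(1)] left_gap_pp[OF x(2)] right_gap_pp[OF y(3)]
  show ?case by blast
qed

text \<open>
  With \<open>k\<close>, \<open>l\<close> and \<open>r\<close> all at most \<open>n - 1\<close>, the inequality of \<open>nonzero_tri_product_shape\<close> gives
  length at most \<open>n\<^sup>2 - 1\<close>.
\<close>

lemma tri_product_square_eq_zero:
  assumes perp: "\<And>x. perp.is_nfold_product n x \<Longrightarrow> x = 0" and "1 \<le> n"
    and x: "tri_product (n * n) x"
  shows "x = 0"
proof (rule ccontr)
  assume "x \<noteq> 0"
  have long: "p = 0" if "n \<le> m" "perp.is_nfold_product m p" for m p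
    using perp.is_nfold_product_eq_zero_mono[of n m p] perp \<open>1 \<le> n\<close> that by blast
  have "u \<turnstile> z = 0" "z \<stileturn> u = 0" if u: "tri_product m u" "n \<le> m" for m u z
  proof -
    obtain p where p: "perp.is_nfold_product m p" "\<And>z. u \<turnstile> z = p \<turnstile> z" "\<And>z. z \<stileturn> u = z \<stileturn> p"
      using exists_perp_product_same_action[OF u(1)] by blast
    moreover have "p = 0" using long[OF u(2) p(1)] .
    ultimately show "u \<turnstile> z = 0" "z \<stileturn> u = 0" by simp_all
  qed
  then have vanish: "\<forall>m u z. tri_product m u \<longrightarrow> n \<le> m \<longrightarrow> u \<turnstile> z = 0"
    "\<forall>m v z. tri_product m v \<longrightarrow> n \<le> m \<longrightarrow> z \<stileturn> v = 0" by blast+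
  obtain k l r where klr: "perp.is_nfold_product k x" "left_gap l x" "right_gap r x"
      "n * n + n \<le> l + r + 1 + k * n"
    using nonzero_tri_product_shape[OF vanish(1) \<open>1 \<le> n\<close> x \<open>x \<noteq> 0\<close>] by blast
  have "l < n" "r < n"
    using left_gap_less[OF vanish(1) klr(2) \<open>x \<noteq> 0\<close> \<open>1 \<le> n\<close>]
      right_gap_less[OF vanish(2) klr(3) \<open>x \<noteq> 0\<close> \<open>1 \<le> n\<close>] by auto
  moreover have "Suc k \<le> n"
    using long[of k x] klr(1) \<open>x \<noteq> 0\<close> by (meson not_less_eq_eq)
  then have "Suc k * n \<le> n * n" by (rule mult_le_mono1)
  ultimately show False using klr(4) by simp
qed

lemma nilpotent_iff_perp_nilpotent: "nilpotent \<longleftrightarrow> perp.nilpotent"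
proof
  assume nilpotent
  then obtain n where "1 \<le> n" "tri_power n = {0}" by (auto simp: nilpotent_def)
  then have "perp.ideal_power n = {0}"
    using perp_product_in_tri_power by (auto simp: perp.ideal_power_eq_zero_iff)
  with \<open>1 \<le> n\<close> show perp.nilpotent by (auto simp: perp.nilpotent_def)
next
  assume perp.nilpotent
  then obtain n where n: "1 \<le> n" "\<And>x. perp.is_nfold_product n x \<Longrightarrow> x = 0"
    by (auto simp: perp.nilpotent_def perp.ideal_power_eq_zero_iff)
  have nn: "1 \<le> n * n" using n(1) by simp
  have "{x. tri_product (n * n) x} \<subseteq> {0}"
    using tri_product_square_eq_zero[OF n(2,1)] by blast
  then have "span {x. tri_product (n * n) x} \<subseteq> {0}"
    by (intro span_minimal) auto
  with tri_power_subset_span[OF nn] have "tri_power (n * n) \<subseteq> {0}" by blast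
  moreover have "0 \<in> tri_power (n * n)"
  proof (cases "n * n = 1")
    case True
    then show ?thesis by simp
  next
    case False
    with nn have "2 \<le> n * n" by linarith
    then have "tri_power 1 \<lozenge> tri_power (n * n - 1) \<subseteq> tri_power (1 + (n * n - 1))"
      by (intro lozenge_subset_tri_power) auto
    with zero_in_lozenge nn show ?thesis by (metis le_add_diff_inverse subsetD)
  qed
  ultimately have "tri_power (n * n) = {0}" by blast
  with nn show nilpotent unfolding nilpotent_def by blast
qed

end

section \<open>Nilpotency is detected by one of the three products\<close>

theorem theorem4p4:
  fixes scale :: "'k::field \<Rightarrow> 'a::ab_group_add \<Rightarrow> 'a"
    and vd dv pp :: "'a \<Rightarrow> 'a \<Rightarrow> 'a"
  assumes "triassociative_algebra scale vd dv pp"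
  shows "triassociative_algebra.nilpotent scale vd dv pp
           \<longleftrightarrow> associative_algebra.nilpotent scale pp"
  using assms by (rule triassociative_algebra.nilpotent_iff_perp_nilpotent)

end
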